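(* (i) Let $S\equiv\pm\{4, 5, 6, 7, 15, 17, 23, 25, 26, 33, 35, 36\}\pmod{80}$ and $T\equiv\pm\{2, 5, 11, 12, 15, 18, 19, 21, 25, 28, 29, 35\}\pmod{80}$. Then $p(S,n)=p(T,n)$ for all integers $n\ge0$ with $n\neq 2$. (ii) Let $S\equiv\pm\{3, 4, 5, 13, 14, 15, 25, 27, 34, 35, 36, 37\}\pmod{80}$ and $T\equiv\pm\{1, 5, 9, 12, 15, 22, 25, 28, 31, 35, 38, 39\}\pmod{80}$. Then $p(S,n)=p(T,n-3)$ for all $n\geq 3$.
   Context: For a set $S$ of positive integers and an integer $n\ge 0$, $p(S,n)$ denotes the number of partitions of $n$ into parts belonging to $S$ (so $p(S,0)=1$). The notation $S\equiv\pm\{r_1,\dots,r_k\}\pmod M$ means that $S$ is the set of all positive integers $n$ such that $n\equiv r_i$ or $n\equiv -r_i\pmod M$ for some $i$. *)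

theory Defs
  imports "HOL-Library.Multiset" "HOL-Number_Theory.Cong"
begin

text \<open>
  A partition of \<open>n\<close> is the multiset of its parts. For \<open>S\<close> a set of positive integers the
  set below is finite, so \<open>card\<close> is the true count.
\<close>

definition num_partitions :: "nat set \<Rightarrow> nat \<Rightarrow> nat" where
  "num_partitions S n = card {P :: nat multiset. set_mset P \<subseteq> S \<and> sum_mset P = n}"

definition pm_residues :: "int set \<Rightarrow> int \<Rightarrow> nat set" where
  "pm_residues R M = {n. n > 0 \<and> (\<exists>r\<in>R. [int n = r] (mod M) \<or> [int n = - r] (mod M))}"

end

theory Submission
  imports Defs "HOL-Computational_Algebra.Formal_Power_Series"
begin

text \<open>
  Write \<open>[r; m]\<close> for the product of \<open>1 - q^s\<close> over all \<open>s > 0\<close> with \<open>s \<equiv> \<plusminus>r (mod m)\<close>, and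
  \<open>f(a, b)\<close> for Ramanujan's theta series in \<open>q^a, q^b\<close>. In (i), the generating function of \<open>p(S, n)\<close>
  is \<open>1 / ([5; 20] [4; 40] [6, 26; 80] [7, 17; 40])\<close>. Expanding the fraction by the factors
  \<open>1 + q^s\<close> with \<open>s \<equiv> \<plusminus>7, \<plusminus>17 (mod 40)\<close> and with \<open>s \<equiv> \<plusminus>6 (mod 20)\<close>, the denominator becomes
  \<open>[5; 20] [4; 40] [12; 40]\<close>; the same denominator arises for \<open>T\<close> and for both sets in (ii). By the
  Jacobi triple product and the product formula for two theta series, all numerators and this common
  denominator are, up to Euler products, polynomials in \<open>q\<close> and the six series \<open>f(30, 50)\<close>, \<open>f(10, 70)\<close>,
  \<open>f(8, 72)\<close>, \<open>f(16, 64)\<close>, \<open>f(24, 56)\<close>, \<open>f(32, 48)\<close>, and in these both statements are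
  polynomial identities.
\<close>

unbundle fps_syntax

section \<open>Congruence of power series up to a given order\<close>

text \<open>This is congruence modulo \<open>fps_X ^ (K + 1)\<close>. Limits are taken by comparing
  infinite products and sums with finite ones to every order \<open>K\<close>.\<close>

definition eq_upto :: "nat \<Rightarrow> real fps \<Rightarrow> real fps \<Rightarrow> bool" where
  "eq_upto K f g \<longleftrightarrow> (\<forall>i\<le>K. f $ i = g $ i)"

lemma eq_upto_refl [simp]: "eq_upto K f f"
  by (simp add: eq_upto_def)

lemma eq_upto_sym: "eq_upto K f g \<Longrightarrow> eq_upto K g f"
  by (simp add: eq_upto_def)

lemma eq_upto_trans [trans]: "eq_upto K f g \<Longrightarrow> eq_upto K g h \<Longrightarrow> eq_upto K f h"
  by (simp add: eq_upto_def)

lemma eq_upto_mult: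
  assumes "eq_upto K f f'" "eq_upto K g g'"
  shows "eq_upto K (f * g) (f' * g')"
  using assms by (auto simp: eq_upto_def fps_mult_nth intro!: sum.cong)

lemma eq_upto_sum:
  assumes "\<And>i. i \<in> I \<Longrightarrow> eq_upto K (f i) (g i)"
  shows "eq_upto K (sum f I) (sum g I)"
  using assms by (auto simp: eq_upto_def fps_sum_nth intro!: sum.cong)

lemma eq_upto_prod:
  assumes "\<And>i. i \<in> I \<Longrightarrow> eq_upto K (f i) (g i)"
  shows "eq_upto K (prod f I) (prod g I)"
  using assms by (induction I rule: infinite_finite_induct) (auto intro: eq_upto_mult)

lemma eq_upto_all_imp_eq: "(\<And>K. eq_upto K f g) \<Longrightarrow> f = g"
  by (rule fps_ext) (auto simp: eq_upto_def)

lemma eq_upto_X_power_mult: "K < n \<Longrightarrow> eq_upto K (fps_X ^ n * f) 0"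
  by (simp add: eq_upto_def fps_X_power_mult_nth)

section \<open>Infinite products\<close>

lemma fps_const_minus_one: "fps_const (-1) = (-1 :: real fps)"
  by (simp flip: fps_const_neg)

text \<open>This encodes the possibly infinite product of \<open>1 + c * fps_X ^ s\<close> over
  \<open>S\<close>: factors with \<open>s > k\<close> are 1 up to order \<open>k\<close>, so the
  finite product over \<open>s <= k\<close> already has the right coefficient at
  \<open>k\<close>.\<close>

definition set_prod :: "real \<Rightarrow> nat set \<Rightarrow> real fps" where
  "set_prod c S = Abs_fps (\<lambda>k. (\<Prod>s\<in>S \<inter> {..k}. 1 + fps_const c * fps_X ^ s) $ k)"

lemma eq_upto_factor: "K < s \<Longrightarrow> eq_upto K (1 + fps_const c * fps_X ^ s) 1"
  by (auto simp: eq_upto_def)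

lemma eq_upto_prod_insert_large:
  assumes "finite A" "B \<subseteq> A" "\<And>s. s \<in> A - B \<Longrightarrow> K < s"
  shows "eq_upto K (\<Prod>s\<in>A. 1 + fps_const c * fps_X ^ s) (\<Prod>s\<in>B. 1 + fps_const c * fps_X ^ s)"
proof -
  have "eq_upto K (\<Prod>s\<in>A - B. 1 + fps_const c * fps_X ^ s) (\<Prod>s\<in>A - B. 1)"
    using assms(3) by (intro eq_upto_prod eq_upto_factor)
  then have "eq_upto K ((\<Prod>s\<in>A - B. 1 + fps_const c * fps_X ^ s) * (\<Prod>s\<in>B. 1 + fps_const c * fps_X ^ s))
      ((\<Prod>s\<in>A - B. 1) * (\<Prod>s\<in>B. 1 + fps_const c * fps_X ^ s))"
    by (intro eq_upto_mult) auto
  then show ?thesis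
    using assms(1,2) by (simp add: prod.subset_diff)
qed

text \<open>Factors with exponent above \<open>K\<close> do not affect the first \<open>K\<close>
  coefficients. The finite set \<open>A\<close> may thus be chosen freely between the truncation of
  \<open>S\<close> and \<open>S\<close>, which lets each application pick the most convenient
  one.\<close>

lemma eq_upto_set_prod:
  assumes "finite A" "A \<subseteq> S" "S \<inter> {..K} \<subseteq> A"
  shows "eq_upto K (set_prod c S) (\<Prod>s\<in>A. 1 + fps_const c * fps_X ^ s)"
  unfolding eq_upto_def
proof (intro allI impI)
  fix i assume "i \<le> K"
  then have "eq_upto i (\<Prod>s\<in>A. 1 + fps_const c * fps_X ^ s)
      (\<Prod>s\<in>S \<inter> {..i}. 1 + fps_const c * fps_X ^ s)"
    using assms by (intro eq_upto_prod_insert_large) auto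
  then show "set_prod c S $ i = (\<Prod>s\<in>A. 1 + fps_const c * fps_X ^ s) $ i"
    by (simp add: eq_upto_def set_prod_def)
qed

lemma set_prod_Un:
  assumes "S \<inter> T = {}"
  shows "set_prod c (S \<union> T) = set_prod c S * set_prod c T"
proof (rule eq_upto_all_imp_eq)
  fix K
  let ?P = "\<lambda>A. \<Prod>s\<in>A. 1 + fps_const c * (fps_X :: real fps) ^ s"
  have "eq_upto K (set_prod c (S \<union> T)) (?P ((S \<inter> {..K}) \<union> (T \<inter> {..K})))"
    by (intro eq_upto_set_prod) auto
  also have "?P ((S \<inter> {..K}) \<union> (T \<inter> {..K})) = ?P (S \<inter> {..K}) * ?P (T \<inter> {..K})"
    using assms by (intro prod.union_disjoint) auto
  also have "eq_upto K \<dots> (set_prod c S * set_prod c T)"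
    by (intro eq_upto_mult eq_upto_sym[OF eq_upto_set_prod]) auto
  finally show "eq_upto K (set_prod c (S \<union> T)) (set_prod c S * set_prod c T)" .
qed

text \<open>Factorwise this is \<open>(1 + q^s) * (1 - q^s) = 1 - q^(2 * s)\<close>.\<close>

lemma set_prod_plus_minus:
  "set_prod 1 S * set_prod (-1) S = set_prod (-1) ((*) 2 ` S)"
proof (rule eq_upto_all_imp_eq)
  fix K
  let ?P = "\<lambda>c A. \<Prod>s\<in>A. 1 + fps_const c * (fps_X :: real fps) ^ s"
  let ?A = "S \<inter> {..K}"
  have "eq_upto K (set_prod 1 S * set_prod (-1) S) (?P 1 ?A * ?P (-1) ?A)"
    by (intro eq_upto_mult eq_upto_set_prod) auto
  also have "?P 1 ?A * ?P (-1) ?A = (\<Prod>s\<in>?A. 1 + fps_const (-1) * fps_X ^ (2 * s))"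
    unfolding prod.distrib[symmetric]
    by (intro prod.cong) (auto simp: fps_const_minus_one algebra_simps mult_2_right power_add)
  also have "\<dots> = ?P (-1) ((*) 2 ` ?A)"
    by (subst prod.reindex) (auto simp: inj_on_def)
  also have "eq_upto K \<dots> (set_prod (-1) ((*) 2 ` S))"
    by (intro eq_upto_sym[OF eq_upto_set_prod]) auto
  finally show "eq_upto K (set_prod 1 S * set_prod (-1) S) (set_prod (-1) ((*) 2 ` S))" .
qed

lemma set_prod_nth_0: "0 \<notin> S \<Longrightarrow> set_prod c S $ 0 = 1"
  by (simp add: set_prod_def)

lemma set_prod_nonzero: "0 \<notin> S \<Longrightarrow> set_prod c S \<noteq> 0"
  using set_prod_nth_0[of S c] by auto

section \<open>Generating functions of weighted families\<close>

text \<open>One notion serves partitions (weight \<open>sum_mset\<close>) and theta series (weight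
  \<open>theta_weight\<close>). A sum over an infinite fibre has the default value 0, so finite
  fibres are assumed where families are split or multiplied.\<close>

definition weight_gf :: "('i \<Rightarrow> nat) \<Rightarrow> ('i \<Rightarrow> real) \<Rightarrow> 'i set \<Rightarrow> real fps" where
  "weight_gf w c I = Abs_fps (\<lambda>k. \<Sum>i\<in>{i\<in>I. w i = k}. c i)"

lemma weight_gf_reindex:
  assumes "bij_betw h J I" "\<And>j. j \<in> J \<Longrightarrow> w (h j) = v j" "\<And>j. j \<in> J \<Longrightarrow> c (h j) = d j"
  shows "weight_gf w c I = weight_gf v d J"
proof (rule fps_ext)
  fix k
  have "bij_betw h {j\<in>J. v j = k} {i\<in>I. w i = k}"
    using assms(1,2) by (auto simp: bij_betw_def inj_on_def)
  from sum.reindex_bij_betw[OF this, of c]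
  show "weight_gf w c I $ k = weight_gf v d J $ k"
    using assms(3) by (simp add: weight_gf_def)
qed

lemma weight_gf_Un:
  assumes "I \<inter> J = {}" "\<And>k. finite {i\<in>I \<union> J. w i = k}"
  shows "weight_gf w c (I \<union> J) = weight_gf w c I + weight_gf w c J"
proof (rule fps_ext)
  fix k
  have "{i\<in>I \<union> J. w i = k} = {i\<in>I. w i = k} \<union> {i\<in>J. w i = k}"
    by auto
  moreover have "finite {i\<in>I. w i = k}" "finite {i\<in>J. w i = k}"
    using assms(2)[of k] by (auto elim: rev_finite_subset)
  moreover have "{i\<in>I. w i = k} \<inter> {i\<in>J. w i = k} = {}"
    using assms(1) by auto
  ultimately show "weight_gf w c (I \<union> J) $ k = (weight_gf w c I + weight_gf w c J) $ k"
    by (simp add: weight_gf_def sum.union_disjoint)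
qed

lemma weight_gf_shift:
  "weight_gf (\<lambda>i. n + w i) (\<lambda>i. x * c i) I = fps_const x * fps_X ^ n * weight_gf w c I"
proof (rule fps_ext)
  fix k
  have "{i\<in>I. n + w i = k} = (if k < n then {} else {i\<in>I. w i = k - n})"
    by auto
  then show "weight_gf (\<lambda>i. n + w i) (\<lambda>i. x * c i) I $ k
      = (fps_const x * fps_X ^ n * weight_gf w c I) $ k"
    by (simp add: weight_gf_def mult.assoc fps_X_power_mult_nth sum_distrib_left)
qed

lemma weight_gf_mult:
  assumes "\<And>k. finite {i\<in>I. w i = k}" "\<And>k. finite {j\<in>J. v j = k}"
  shows "weight_gf w c I * weight_gf v d J
    = weight_gf (\<lambda>(i, j). w i + v j) (\<lambda>(i, j). c i * d j) (I \<times> J)"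
proof (rule fps_ext)
  fix k
  let ?F = "\<lambda>l. {i\<in>I. w i = l} \<times> {j\<in>J. v j = k - l}"
  have "(weight_gf w c I * weight_gf v d J) $ k
      = (\<Sum>l=0..k. \<Sum>(i, j)\<in>?F l. c i * d j)"
    by (simp add: fps_mult_nth weight_gf_def sum_product sum.cartesian_product)
  also have "\<dots> = (\<Sum>(i, j)\<in>(\<Union>l\<in>{0..k}. ?F l). c i * d j)"
    by (rule sum.UNION_disjoint[symmetric]) (auto intro!: finite_cartesian_product assms)
  also have "(\<Union>l\<in>{0..k}. ?F l) = {p \<in> I \<times> J. (case p of (i, j) \<Rightarrow> w i + v j) = k}"
    by auto
  finally show "(weight_gf w c I * weight_gf v d J) $ k
      = weight_gf (\<lambda>(i, j). w i + v j) (\<lambda>(i, j). c i * d j) (I \<times> J) $ k"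
    by (simp add: weight_gf_def)
qed

section \<open>Partitions\<close>

text \<open>All parts are positive, so both the number of parts and each part are bounded by
  \<open>n\<close>.\<close>

lemma finite_partitions:
  assumes "0 \<notin> S"
  shows "finite {P :: nat multiset. set_mset P \<subseteq> S \<and> sum_mset P = n}"
proof (rule finite_subset)
  show "finite (\<Union>k\<le>n. multisets_of_size {..n} k)"
    by (intro finite_UN_I finite_multisets_of_size) auto
next
  have "size P \<le> sum_mset P" if "set_mset P \<subseteq> S" for P :: "nat multiset"
    using that
  proof (induction P)
    case (add x P)
    then have "x > 0" using assms by (cases x) auto
    with add show ?case by simp
  qed simp
  moreover have "x \<le> sum_mset P" if "x \<in># P" for x and P :: "nat multiset"
    using that by (auto dest: multi_member_split)
  ultimately show "{P. set_mset P \<subseteq> S \<and> sum_mset P = n}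
      \<subseteq> (\<Union>k\<le>n. multisets_of_size {..n} k)"
    by (fastforce simp: multisets_of_size_def)
qed

definition partition_gf :: "nat set \<Rightarrow> real fps" where
  "partition_gf S = weight_gf sum_mset (\<lambda>_. 1) {P. set_mset P \<subseteq> S}"

lemma partition_gf_nth: "partition_gf S $ n = real (num_partitions S n)"
  by (simp add: partition_gf_def weight_gf_def num_partitions_def)

text \<open>A multiset over \<open>insert s S\<close> either avoids \<open>s\<close> or arises in
  exactly one way by adding one copy of \<open>s\<close>. Hence the generating function
  \<open>G\<close> of the larger set satisfies
  \<open>G = partition_gf S + fps_X ^ s * G\<close>.\<close>

lemma partition_gf_insert:
  assumes "0 \<notin> insert s S" "s \<notin> S"
  shows "(1 + fps_const (-1) * fps_X ^ s) * partition_gf (insert s S) = partition_gf S"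
proof -
  let ?I = "{P. set_mset P \<subseteq> insert s S}"
  have I: "?I = {P. set_mset P \<subseteq> S} \<union> add_mset s ` ?I"
  proof (intro equalityI subsetI)
    fix P assume P: "P \<in> ?I"
    show "P \<in> {P. set_mset P \<subseteq> S} \<union> add_mset s ` ?I"
    proof (cases "s \<in># P")
      case True
      then show ?thesis using P by (auto dest!: multi_member_split)
    qed (use P in auto)
  qed auto
  have "partition_gf (insert s S)
      = partition_gf S + weight_gf sum_mset (\<lambda>_. 1) (add_mset s ` ?I)"
    unfolding partition_gf_def
  proof (subst I, rule weight_gf_Un)
    show "finite {P \<in> {P. set_mset P \<subseteq> S} \<union> add_mset s ` ?I. sum_mset P = k}" for k
      unfolding I[symmetric] using finite_partitions[OF assms(1)] by simp
  qed (use assms(2) in auto)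
  also have "weight_gf sum_mset (\<lambda>_. 1) (add_mset s ` ?I)
      = weight_gf (\<lambda>P. s + sum_mset P) (\<lambda>_. 1 * 1) ?I"
    by (rule weight_gf_reindex[of "add_mset s"]) (auto simp: bij_betw_def inj_on_def)
  also have "\<dots> = fps_const 1 * fps_X ^ s * partition_gf (insert s S)"
    unfolding partition_gf_def by (rule weight_gf_shift)
  finally show ?thesis by (simp add: fps_const_minus_one algebra_simps)
qed

lemma finite_prod_partition_gf:
  assumes "finite S" "0 \<notin> S"
  shows "(\<Prod>s\<in>S. 1 + fps_const (-1) * fps_X ^ s) * partition_gf S = 1"
  using assms
proof (induction S)
  case empty
  show ?case
  proof (rule fps_ext)
    fix n :: nat
    have "{P. set_mset P \<subseteq> {} \<and> sum_mset P = n} = (if n = 0 then {{#}} else {})"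
      by auto
    then show "((\<Prod>s\<in>{}. 1 + fps_const (-1) * fps_X ^ s) * partition_gf {}) $ n = 1 $ n"
      by (simp add: partition_gf_nth num_partitions_def)
  qed
next
  case (insert s S)
  then have "(\<Prod>s\<in>S. 1 + fps_const (-1) * fps_X ^ s)
      * ((1 + fps_const (-1) * fps_X ^ s) * partition_gf (insert s S)) = 1"
    by (subst partition_gf_insert) auto
  then show ?case
    using insert by (simp add: mult_ac)
qed

text \<open>Partitions of \<open>k <= K\<close> only use parts up to \<open>K\<close>, so up to
  order \<open>K\<close> the claim is that for the finite set
  \<open>S \<inter> {..K}\<close>.\<close>

lemma set_prod_partition_gf:
  assumes "0 \<notin> S"
  shows "set_prod (-1) S * partition_gf S = 1"
proof (rule eq_upto_all_imp_eq)
  fix K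
  have "partition_gf S $ k = partition_gf (S \<inter> {..K}) $ k" if "k \<le> K" for k
  proof -
    have "x \<le> sum_mset P" if "x \<in># P" for x and P :: "nat multiset"
      using that by (auto dest: multi_member_split)
    then have "{P. set_mset P \<subseteq> S \<and> sum_mset P = k} = {P. set_mset P \<subseteq> S \<inter> {..K} \<and> sum_mset P = k}"
      using that by fastforce
    then show ?thesis by (simp add: partition_gf_nth num_partitions_def)
  qed
  then have "eq_upto K (set_prod (-1) S * partition_gf S)
     ((\<Prod>s\<in>S \<inter> {..K}. 1 + fps_const (-1) * fps_X ^ s) * partition_gf (S \<inter> {..K}))"
    by (intro eq_upto_mult eq_upto_set_prod) (auto simp: eq_upto_def)
  then show "eq_upto K (set_prod (-1) S * partition_gf S) 1"
    using assms finite_prod_partition_gf[of "S \<inter> {..K}"] by simp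
qed

section \<open>Theta series\<close>

definition theta_weight :: "nat \<Rightarrow> nat \<Rightarrow> int \<Rightarrow> nat" where
  "theta_weight a b n = a * nat (n * (n + 1) div 2) + b * nat (n * (n - 1) div 2)"

text \<open>For \<open>c * c = 1\<close> this is the \<open>n\<close>-th power of \<open>c\<close>,
  for negative \<open>n\<close> as well.\<close>

definition theta_sign :: "real \<Rightarrow> int \<Rightarrow> real" where
  "theta_sign c n = (if even n then 1 else c)"

text \<open>For \<open>c = 1\<close> or \<open>c = -1\<close> this is Ramanujan's \<open>f(c X^a, c X^b)\<close>.\<close>

definition theta :: "real \<Rightarrow> nat \<Rightarrow> nat \<Rightarrow> real fps" where
  "theta c a b = weight_gf (theta_weight a b) (theta_sign c) UNIV"

text \<open>Doubling removes \<open>div\<close> and \<open>nat\<close>, so that identities between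
  exponents become polynomial identities over the integers.\<close>

lemma two_theta_weight:
  "2 * int (theta_weight a b n) = (int a + int b) * n\<^sup>2 + (int a - int b) * n"
proof -
  have *: "0 \<le> n * (n + 1)" "0 \<le> n * (n - 1)"
    by (simp_all only: zero_le_mult_iff) presburger+
  have "2 * int (theta_weight a b n)
      = int a * (2 * (n * (n + 1) div 2)) + int b * (2 * (n * (n - 1) div 2))"
    using * by (simp add: theta_weight_def algebra_simps)
  also have "\<dots> = int a * (n * (n + 1)) + int b * (n * (n - 1))"
    by simp
  finally show ?thesis by (simp add: algebra_simps power2_eq_square)
qed

lemma theta_weight_eqI:
  assumes "2 * int k = (int a + int b) * n\<^sup>2 + (int a - int b) * n"
  shows "theta_weight a b n = k"
  using two_theta_weight[of a b n] assms by linarith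

lemma theta_weight_minus: "theta_weight a b (- n) = theta_weight b a n"
  by (rule theta_weight_eqI) (simp add: two_theta_weight algebra_simps)

text \<open>Both \<open>n\<^sup>2 + n\<close> and \<open>n\<^sup>2 - n\<close> are nonnegative, so
  replacing \<open>a\<close> and \<open>b\<close> by 1 only lowers the weight, and leaves
  \<open>n\<^sup>2\<close>. The bound gives finite fibres and controls the truncation of theta
  series.\<close>

lemma abs_le_theta_weight:
  assumes "a > 0" "b > 0"
  shows "\<bar>n\<bar> \<le> int (theta_weight a b n)"
proof -
  have "\<bar>n\<bar> * 1 \<le> \<bar>n\<bar> * \<bar>n\<bar>"
    by (cases "n = 0") (simp, rule mult_left_mono, auto)
  then have n: "\<bar>n\<bar> \<le> n\<^sup>2"
    by (simp add: power2_eq_square)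
  have "1 * (n\<^sup>2 + n) \<le> int a * (n\<^sup>2 + n)" "1 * (n\<^sup>2 - n) \<le> int b * (n\<^sup>2 - n)"
    by (rule mult_right_mono; use assms n in linarith)+
  then have "2 * n\<^sup>2 \<le> int a * (n\<^sup>2 + n) + int b * (n\<^sup>2 - n)"
    using add_mono by fastforce
  also have "\<dots> = 2 * int (theta_weight a b n)"
    by (simp add: two_theta_weight algebra_simps)
  finally show ?thesis using n by simp
qed

lemma finite_theta_weight:
  assumes "a > 0" "b > 0"
  shows "finite {n. theta_weight a b n = k}"
proof (rule finite_subset)
  show "{n. theta_weight a b n = k} \<subseteq> {- int k..int k}"
  proof
    fix n assume "n \<in> {n. theta_weight a b n = k}"
    then show "n \<in> {- int k..int k}"
      using abs_le_theta_weight[OF assms, of n] by auto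
  qed
qed simp

text \<open>The even and the odd indices are summed separately; each half is again a theta series,
  the odd one carrying the sign \<open>c\<close>.\<close>

lemma theta_dissect:
  assumes "0 < a" "a < b" "c * c = 1"
  shows "theta c a b = theta 1 (3 * a + b) (a + 3 * b)
    + fps_const c * fps_X ^ a * theta 1 (b - a) (5 * a + 3 * b)"
proof -
  let ?w = "theta_weight a b"
  have U: "UNIV = {n::int. even n} \<union> {n. odd n}" by auto
  have "theta c a b = weight_gf ?w (theta_sign c) {n. even n} + weight_gf ?w (theta_sign c) {n. odd n}"
    unfolding theta_def
    by (subst U, rule weight_gf_Un) (use assms finite_theta_weight in auto)
  also have "weight_gf ?w (theta_sign c) {n. even n} = theta 1 (3 * a + b) (a + 3 * b)"
    unfolding theta_def
  proof (rule weight_gf_reindex[of "\<lambda>n. 2 * n"])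
    show "bij_betw (\<lambda>n::int. 2 * n) UNIV {n. even n}"
      by (auto simp: bij_betw_def inj_on_def elim: evenE)
    show "theta_weight a b (2 * j) = theta_weight (3 * a + b) (a + 3 * b) j" for j
      by (rule theta_weight_eqI) (simp add: two_theta_weight algebra_simps power2_eq_square)
  qed (auto simp: theta_sign_def)
  also have "weight_gf ?w (theta_sign c) {n. odd n}
      = weight_gf (\<lambda>n. a + theta_weight (b - a) (5 * a + 3 * b) n) (\<lambda>n. c * theta_sign 1 n) UNIV"
  \<comment> \<open>Odd indices are written as \<open>1 - 2 * n\<close> rather than
    \<open>1 + 2 * n\<close> so that the smaller argument \<open>b - a\<close> comes first.\<close>
  proof (rule weight_gf_reindex[of "\<lambda>n. 1 - 2 * n"])
    show "bij_betw (\<lambda>n::int. 1 - 2 * n) UNIV {n. odd n}"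
    proof (rule bij_betwI[of _ _ _ "\<lambda>n. (1 - n) div 2"])
    qed (auto elim: oddE)
    show "theta_weight a b (1 - 2 * j) = a + theta_weight (b - a) (5 * a + 3 * b) j" for j
      using assms
      by (intro theta_weight_eqI) (simp add: two_theta_weight algebra_simps power2_eq_square of_nat_diff)
  qed (auto simp: theta_sign_def)
  also have "\<dots> = fps_const c * fps_X ^ a * theta 1 (b - a) (5 * a + 3 * b)"
    unfolding theta_def by (rule weight_gf_shift)
  finally show ?thesis .
qed

text \<open>The lattice \<open>\<int> \<times> \<int>\<close> is split according to the parity of \<open>m + n\<close>, and the
  coordinates \<open>(m \<plusminus> n) / 2\<close> are used on each half.\<close>

lemma theta_mult:
  assumes "a + b = c + d" "0 < a" "a < c" "a < d" "e * e = 1"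
  shows "theta e a b * theta e c d = theta 1 (a + c) (b + d) * theta 1 (a + d) (b + c)
    + fps_const e * fps_X ^ a * (theta 1 (b - c) (a + 2 * c + d) * theta 1 (b - d) (a + c + 2 * d))"
proof -
  let ?w = "\<lambda>(m, n). theta_weight a b m + theta_weight c d n"
  let ?s = "\<lambda>(m, n). theta_sign e m * theta_sign e n"
  have b: "int b = int c + int d - int a" and pos: "a > 0" "b > 0" "c > 0" "d > 0" "b > c" "b > d"
    using assms by auto
  have bc: "int (b - c) = int d - int a" "int (b - d) = int c - int a"
    using assms by auto
  have U: "UNIV = {(m, n). even (m + n :: int)} \<union> {(m, n). odd (m + n)}" by auto
  have prod: "weight_gf w f UNIV * weight_gf v g UNIV
      = weight_gf (\<lambda>(i, j). w i + v j) (\<lambda>(i, j). f i * g j) UNIV"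
    if "\<And>k. finite {i. w i = k}" "\<And>k. finite {i. v i = k}"
    for w v :: "int \<Rightarrow> nat" and f g :: "int \<Rightarrow> real"
    using weight_gf_mult[of UNIV w UNIV v f g] that by simp
  have fin: "finite {p. ?w p = k}" for k
  proof (rule finite_subset)
    show "{p. ?w p = k} \<subseteq> {- int k..int k} \<times> {- int k..int k}"
    proof
      fix p assume "p \<in> {p. ?w p = k}"
      then obtain m n where "p = (m, n)" "theta_weight a b m + theta_weight c d n = k"
        by (cases p) auto
      then show "p \<in> {- int k..int k} \<times> {- int k..int k}"
        using abs_le_theta_weight[of a b m] abs_le_theta_weight[of c d n] assms pos by auto
    qed
  qed simp
  have "theta e a b * theta e c d = weight_gf ?w ?s UNIV"
    unfolding theta_def by (rule prod) ((rule finite_theta_weight; simp add: pos)+)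
  also have "\<dots> = weight_gf ?w ?s {(m, n). even (m + n)} + weight_gf ?w ?s {(m, n). odd (m + n)}"
  proof (subst U, rule weight_gf_Un)
    show "finite {p \<in> {(m, n). even (m + n)} \<union> {(m, n). odd (m + n)}. ?w p = k}" for k
      by (rule finite_subset[OF _ fin[of k]]) blast
  qed blast
  finally have split: "theta e a b * theta e c d
      = weight_gf ?w ?s {(m, n). even (m + n)} + weight_gf ?w ?s {(m, n). odd (m + n)}" .
  have "weight_gf ?w ?s {(m, n). even (m + n)}
      = weight_gf (\<lambda>(r, s). theta_weight (a + c) (b + d) r + theta_weight (a + d) (b + c) s)
          (\<lambda>(r, s). theta_sign 1 r * theta_sign 1 s) UNIV"
  proof (rule weight_gf_reindex[of "\<lambda>(r, s). (r + s, r - s)"])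
    show "bij_betw (\<lambda>(r, s). (r + s, r - s)) UNIV {(m, n :: int). even (m + n)}"
    proof (rule bij_betwI[of _ _ _ "\<lambda>(m, n). ((m + n) div 2, (m - n) div 2)"])
      show "(\<lambda>(r, s). (r + s, r - s)) ((\<lambda>(m, n). ((m + n) div 2, (m - n) div 2)) p) = p"
        if "p \<in> {(m, n :: int). even (m + n)}" for p
      proof (cases p)
        case (Pair m n)
        then have "even (m + n)" using that by simp
        then have "(m + n) div 2 + (m - n) div 2 = m" "(m + n) div 2 - (m - n) div 2 = n"
          by presburger+
        then show ?thesis by (simp only: Pair prod.case)
      qed
    qed auto
    show "?w (case j of (r, s) \<Rightarrow> (r + s, r - s))
        = (case j of (r, s) \<Rightarrow> theta_weight (a + c) (b + d) r + theta_weight (a + d) (b + c) s)" for j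
    proof (cases j)
      case (Pair r s)
      \<comment> \<open>The coefficient of \<open>r * s\<close> is a multiple of
        \<open>a + b - (c + d) = 0\<close>, so the exponent separates into a part in
        \<open>r\<close> and a part in \<open>s\<close>.\<close>
      have "2 * int (theta_weight a b (r + s) + theta_weight c d (r - s))
          = 2 * int (theta_weight (a + c) (b + d) r + theta_weight (a + d) (b + c) s)"
        by (simp add: distrib_left two_theta_weight b) (simp add: algebra_simps power2_eq_square)
      then show ?thesis using Pair by simp
    qed
  qed (auto simp: theta_sign_def assms(5))
  also have "\<dots> = theta 1 (a + c) (b + d) * theta 1 (a + d) (b + c)"
    unfolding theta_def by (rule prod[symmetric]) ((rule finite_theta_weight; simp add: pos)+)
  finally have even: "weight_gf ?w ?s {(m, n). even (m + n)}
      = theta 1 (a + c) (b + d) * theta 1 (a + d) (b + c)" .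
  have "weight_gf ?w ?s {(m, n). odd (m + n)}
      = weight_gf (\<lambda>p. a + (\<lambda>(r, s). theta_weight (b - c) (a + 2 * c + d) r
            + theta_weight (b - d) (a + c + 2 * d) s) p)
          (\<lambda>p. e * (\<lambda>(r, s). theta_sign 1 r * theta_sign 1 s) p) UNIV"
  \<comment> \<open>The origin goes to \<open>(1, 0)\<close>, whose weight \<open>a\<close> is the
    factor pulled out in front. The signs are chosen so that the first arguments become
    \<open>b - c\<close> and \<open>b - d\<close>.\<close>
  proof (rule weight_gf_reindex[of "\<lambda>(r, s). (1 - r - s, s - r)"])
    show "bij_betw (\<lambda>(r, s). (1 - r - s, s - r)) UNIV {(m, n :: int). odd (m + n)}"
    proof (rule bij_betwI[of _ _ _ "\<lambda>(m, n). ((1 - m - n) div 2, (1 - m + n) div 2)"])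
      show "(\<lambda>(r, s). (1 - r - s, s - r)) ((\<lambda>(m, n). ((1 - m - n) div 2, (1 - m + n) div 2)) p) = p"
        if "p \<in> {(m, n :: int). odd (m + n)}" for p
      proof (cases p)
        case (Pair m n)
        then have "odd (m + n)" using that by simp
        then have "1 - (1 - m - n) div 2 - (1 - m + n) div 2 = m"
          "(1 - m + n) div 2 - (1 - m - n) div 2 = n"
          by presburger+
        then show ?thesis by (simp only: Pair prod.case)
      qed
    qed auto
    show "?w (case j of (r, s) \<Rightarrow> (1 - r - s, s - r))
        = a + (case j of (r, s) \<Rightarrow> theta_weight (b - c) (a + 2 * c + d) r
            + theta_weight (b - d) (a + c + 2 * d) s)" for j
    proof (cases j)
      case (Pair r s)
      have "2 * int (theta_weight a b (1 - r - s) + theta_weight c d (s - r))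
          = 2 * int (a + (theta_weight (b - c) (a + 2 * c + d) r
            + theta_weight (b - d) (a + c + 2 * d) s))"
        by (simp add: distrib_left two_theta_weight b bc) (simp add: algebra_simps power2_eq_square)
      then show ?thesis using Pair by simp
    qed
  qed (auto simp: theta_sign_def assms(5))
  also have "\<dots> = fps_const e * fps_X ^ a
      * weight_gf (\<lambda>(r, s). theta_weight (b - c) (a + 2 * c + d) r
            + theta_weight (b - d) (a + c + 2 * d) s)
          (\<lambda>(r, s). theta_sign 1 r * theta_sign 1 s) UNIV"
    by (rule weight_gf_shift)
  also have "\<dots> = fps_const e * fps_X ^ a
      * (theta 1 (b - c) (a + 2 * c + d) * theta 1 (b - d) (a + c + 2 * d))"
    unfolding theta_def by (subst prod) ((rule finite_theta_weight; simp add: pos)+, rule refl)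
  finally have odd: "weight_gf ?w ?s {(m, n). odd (m + n)} = fps_const e * fps_X ^ a
      * (theta 1 (b - c) (a + 2 * c + d) * theta 1 (b - d) (a + c + 2 * d))" .
  show ?thesis unfolding split even odd ..
qed

section \<open>The Jacobi triple product\<close>

definition qpoch :: "nat \<Rightarrow> nat \<Rightarrow> real fps" where
  "qpoch m n = (\<Prod>i<n. 1 - fps_X ^ (m * Suc i))"

text \<open>This is the Gaussian binomial coefficient in base \<open>fps_X ^ m\<close>. Its value 0
  for \<open>k > n\<close> makes the Pascal rule hold at the boundary \<open>k = n\<close>.\<close>

definition qbinom :: "nat \<Rightarrow> nat \<Rightarrow> nat \<Rightarrow> real fps" where
  "qbinom m n k = (if k \<le> n then qpoch m n * inverse (qpoch m k) * inverse (qpoch m (n - k)) else 0)"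

definition theta_term :: "real \<Rightarrow> nat \<Rightarrow> nat \<Rightarrow> int \<Rightarrow> real fps" where
  "theta_term c a b j = fps_const (theta_sign c j) * fps_X ^ theta_weight a b j"

lemma qpoch_nth_0: "m > 0 \<Longrightarrow> qpoch m n $ 0 = 1"
  by (induction n) (auto simp: qpoch_def fps_mult_nth)

lemma qpoch_Suc: "qpoch m (Suc n) = qpoch m n * (1 - fps_X ^ (m * Suc n))"
  by (simp add: qpoch_def)

lemma inverse_qpoch_mult: "m > 0 \<Longrightarrow> inverse (qpoch m n) * qpoch m n = 1"
  by (rule inverse_mult_eq_1) (simp add: qpoch_nth_0)

lemma inverse_qpoch_Suc:
  assumes "m > 0"
  shows "inverse (qpoch m n) = inverse (qpoch m (Suc n)) * (1 - fps_X ^ (m * Suc n))"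
proof -
  have "inverse (qpoch m n) = inverse (qpoch m n) * (inverse (qpoch m (Suc n)) * qpoch m (Suc n))"
    using assms by (simp add: inverse_qpoch_mult)
  also have "\<dots> = (inverse (qpoch m n) * qpoch m n) * (inverse (qpoch m (Suc n)) * (1 - fps_X ^ (m * Suc n)))"
    by (simp add: qpoch_Suc mult_ac)
  finally show ?thesis using assms by (simp add: inverse_qpoch_mult)
qed

lemma qbinom_0 [simp]: "m > 0 \<Longrightarrow> qbinom m n 0 = 1"
  using inverse_qpoch_mult[of m n] by (simp add: qbinom_def qpoch_def mult.commute)

lemma qbinom_self [simp]: "m > 0 \<Longrightarrow> qbinom m n n = 1"
  using inverse_qpoch_mult[of m n] by (simp add: qbinom_def qpoch_def mult.commute)

lemma qbinom_symmetric: "k \<le> n \<Longrightarrow> qbinom m n (n - k) = qbinom m n k"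
  by (simp add: qbinom_def mult_ac)

text \<open>For \<open>k < n\<close>, over a common denominator the rule reads
  \<open>1 - y * x = (1 - y) + y * (1 - x)\<close> with \<open>y = fps_X ^ (m * (n - k))\<close> and
  \<open>x = fps_X ^ (m * Suc k)\<close>.\<close>

lemma qbinom_Suc_Suc:
  assumes "m > 0" "k \<le> n"
  shows "qbinom m (Suc n) (Suc k) = qbinom m n (Suc k) + fps_X ^ (m * (n - k)) * qbinom m n k"
proof (cases "k = n")
  case True
  then show ?thesis using assms by (simp add: qbinom_def[of m n "Suc n"])
next
  case False
  then obtain l where n: "n = Suc (k + l)"
    using assms(2) less_imp_Suc_add[of k n] by auto
  let ?u = "inverse (qpoch m (Suc k))" and ?v = "inverse (qpoch m (Suc l))"
  have 1: "qbinom m n (Suc k) = qpoch m n * ?u * (?v * (1 - fps_X ^ (m * Suc l)))"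
    using inverse_qpoch_Suc[OF assms(1), of l] by (simp add: qbinom_def n)
  have 2: "qbinom m n k = qpoch m n * (?u * (1 - fps_X ^ (m * Suc k))) * ?v"
    using inverse_qpoch_Suc[OF assms(1), of k] by (simp add: qbinom_def n Suc_diff_le)
  have 3: "qbinom m (Suc n) (Suc k)
      = qpoch m n * (1 - fps_X ^ (m * Suc l) * fps_X ^ (m * Suc k)) * ?u * ?v"
  proof -
    have "m * Suc n = m * Suc l + m * Suc k" by (simp add: n algebra_simps)
    then have "qpoch m (Suc n) = qpoch m n * (1 - fps_X ^ (m * Suc l) * fps_X ^ (m * Suc k))"
      by (simp only: qpoch_Suc power_add)
    then show ?thesis by (simp add: qbinom_def n Suc_diff_le)
  qed
  have 4: "n - k = Suc l" by (simp add: n)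
  have "p * (1 - y * x) * u * v = p * u * (v * (1 - y)) + y * (p * (u * (1 - x)) * v)"
    for p u v x y :: "real fps"
    by (simp add: algebra_simps)
  then show ?thesis unfolding 1 2 3 4 .
qed

section \<open>The finite form of the triple product\<close>

lemma theta_term_step:
  assumes "j \<le> int n" "c * c = 1"
  shows "theta_term c a b j * (fps_const c * fps_X ^ (a + (a + b) * n))
    = fps_X ^ ((a + b) * nat (int n - j)) * theta_term c a b (j + 1)"
proof -
  \<comment> \<open>From \<open>j\<close> to \<open>j + 1\<close> the weight grows by
    \<open>a + (a + b) * j\<close>; the rest of the exponent \<open>a + (a + b) * n\<close> is
    \<open>(a + b) * (n - j)\<close>, the power occurring in the Pascal rule.\<close>
  have "2 * int (theta_weight a b j + (a + (a + b) * n))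
      = 2 * int ((a + b) * nat (int n - j) + theta_weight a b (j + 1))"
    using assms(1) by (simp add: distrib_left two_theta_weight) (simp add: algebra_simps power2_eq_square)
  then have "theta_weight a b j + (a + (a + b) * n)
      = (a + b) * nat (int n - j) + theta_weight a b (j + 1)"
    by (simp only: mult_cancel_left of_nat_eq_iff) simp
  then have "fps_X ^ theta_weight a b j * fps_X ^ (a + (a + b) * n)
      = fps_X ^ ((a + b) * nat (int n - j)) * (fps_X :: real fps) ^ theta_weight a b (j + 1)"
    by (simp only: flip: power_add)
  moreover have "fps_const (theta_sign c j) * fps_const c = fps_const (theta_sign c (j + 1))"
    using assms(2) by (simp add: theta_sign_def)
  ultimately show ?thesis
    unfolding theta_term_def by (simp add: mult_ac)
qed

text \<open>By induction on \<open>n\<close>: a new factor turns each term into itself plus a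
  multiple of the next one, and the Pascal rule combines the two contributions. The factor
  \<open>F\<close> is kept general so that the lemma can build up both products in turn.\<close>

lemma finite_triple_product_step:
  assumes "a + b > 0" "c * c = 1"
    and base: "F = (\<Sum>k\<le>r. qbinom (a + b) r k * theta_term c a b (int k - int r))"
  shows "(\<Prod>k<n. 1 + fps_const c * fps_X ^ (a + (a + b) * k)) * F
    = (\<Sum>k\<le>n + r. qbinom (a + b) (n + r) k * theta_term c a b (int k - int r))"
proof (induction n)
  case 0
  then show ?case using base by simp
next
  case (Suc n)
  let ?N = "n + r" and ?q = "qbinom (a + b)" and ?T = "\<lambda>k. theta_term c a b (int k - int r)"
  have step: "?T k * (fps_const c * fps_X ^ (a + (a + b) * n)) = fps_X ^ ((a + b) * (?N - k)) * ?T (Suc k)"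
    if "k \<le> ?N" for k
  proof -
    have 1: "nat (int n - (int k - int r)) = ?N - k" using that by linarith
    have 2: "int k - int r + 1 = int (Suc k) - int r" by simp
    have "int k - int r \<le> int n" using that by linarith
    from theta_term_step[OF this assms(2)] show ?thesis by (simp only: 1 2)
  qed
  let ?f = "1 + fps_const c * fps_X ^ (a + (a + b) * n)"
  have "(\<Prod>k<Suc n. 1 + fps_const c * fps_X ^ (a + (a + b) * k)) * F
      = ((\<Prod>k<n. 1 + fps_const c * fps_X ^ (a + (a + b) * k)) * F) * ?f"
    by (simp only: prod.lessThan_Suc mult_ac)
  also have "\<dots> = (\<Sum>k\<le>?N. ?q ?N k * ?T k) * ?f"
    unfolding Suc ..
  also have "\<dots> = (\<Sum>k\<le>?N. ?q ?N k * ?T k)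
      + (\<Sum>k\<le>?N. ?q ?N k * (?T k * (fps_const c * fps_X ^ (a + (a + b) * n))))"
    by (simp only: distrib_left sum_distrib_right mult_1_right mult.assoc)
  also have "\<dots> = (?q ?N 0 * ?T 0 + (\<Sum>k\<le>?N. ?q ?N (Suc k) * ?T (Suc k)))
      + (\<Sum>k\<le>?N. fps_X ^ ((a + b) * (?N - k)) * ?q ?N k * ?T (Suc k))"
  proof (rule arg_cong2[where f = "(+)"])
    \<comment> \<open>The added summand is 0 because its binomial has upper index \<open>?N\<close>
      and lower index \<open>Suc ?N\<close>.\<close>
    have "(\<Sum>k\<le>?N. ?q ?N k * ?T k) = (\<Sum>k\<le>Suc ?N. ?q ?N k * ?T k)"
      by (simp add: qbinom_def[of _ ?N "Suc ?N"])
    then show "(\<Sum>k\<le>?N. ?q ?N k * ?T k) = ?q ?N 0 * ?T 0 + (\<Sum>k\<le>?N. ?q ?N (Suc k) * ?T (Suc k))"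
      by (simp only: sum.atMost_Suc_shift)
    show "(\<Sum>k\<le>?N. ?q ?N k * (?T k * (fps_const c * fps_X ^ (a + (a + b) * n))))
        = (\<Sum>k\<le>?N. fps_X ^ ((a + b) * (?N - k)) * ?q ?N k * ?T (Suc k))"
    proof (rule sum.cong)
      fix k assume "k \<in> {..?N}"
      then have "k \<le> ?N" by simp
      show "?q ?N k * (?T k * (fps_const c * fps_X ^ (a + (a + b) * n)))
          = fps_X ^ ((a + b) * (?N - k)) * ?q ?N k * ?T (Suc k)"
        unfolding step[OF \<open>k \<le> ?N\<close>] by (simp only: mult_ac)
    qed simp
  qed
  also have "\<dots> = ?q (Suc ?N) 0 * ?T 0 + (\<Sum>k\<le>?N. ?q (Suc ?N) (Suc k) * ?T (Suc k))"
  proof -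
    have "(\<Sum>k\<le>?N. ?q (Suc ?N) (Suc k) * ?T (Suc k))
        = (\<Sum>k\<le>?N. ?q ?N (Suc k) * ?T (Suc k) + fps_X ^ ((a + b) * (?N - k)) * ?q ?N k * ?T (Suc k))"
      using assms(1) by (intro sum.cong refl) (simp only: qbinom_Suc_Suc atMost_iff distrib_right)
    then show ?thesis
      using assms(1) by (simp only: sum.distrib qbinom_0 add.assoc)
  qed
  also have "\<dots> = (\<Sum>k\<le>Suc ?N. ?q (Suc ?N) k * ?T k)"
    by (rule sum.atMost_Suc_shift[symmetric])
  finally show ?case by simp
qed

lemma finite_triple_product:
  assumes "a + b > 0" "c * c = 1"
  shows "(\<Prod>k<n. 1 + fps_const c * fps_X ^ (a + (a + b) * k))
      * (\<Prod>k<r. 1 + fps_const c * fps_X ^ (b + (a + b) * k))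
    = (\<Sum>k\<le>n + r. qbinom (a + b) (n + r) k * theta_term c a b (int k - int r))"
proof (rule finite_triple_product_step[OF assms])
  \<comment> \<open>The product over \<open>b\<close> is the step lemma with \<open>a\<close> and
    \<open>b\<close> exchanged, starting from \<open>F = 1\<close>. Reversing the summation and
    negating the index then restore the order of \<open>a\<close> and \<open>b\<close>.\<close>
  have "(\<Prod>k<r. 1 + fps_const c * fps_X ^ (b + (b + a) * k)) * 1
      = (\<Sum>k\<le>r + 0. qbinom (b + a) (r + 0) k * theta_term c b a (int k - int 0))"
    by (rule finite_triple_product_step)
      (use assms in \<open>auto simp: theta_term_def theta_sign_def theta_weight_def\<close>)
  also have "\<dots> = (\<Sum>k\<le>r. qbinom (a + b) r (r - k) * theta_term c a b (- int k))"
    by (intro sum.cong)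
      (auto simp: qbinom_symmetric add.commute theta_term_def theta_sign_def theta_weight_minus)
  also have "\<dots> = (\<Sum>k\<le>r. qbinom (a + b) r k * theta_term c a b (int k - int r))"
    by (rule sum.reindex_bij_witness[of _ "\<lambda>k. r - k" "\<lambda>k. r - k"]) (auto simp: of_nat_diff)
  finally show "(\<Prod>k<r. 1 + fps_const c * fps_X ^ (b + (a + b) * k))
      = (\<Sum>k\<le>r. qbinom (a + b) r k * theta_term c a b (int k - int r))"
    by (simp add: add.commute)
qed

section \<open>The limit of the finite form\<close>

definition residue_set :: "nat \<Rightarrow> nat set \<Rightarrow> nat set" where
  "residue_set m R = {n. n > 0 \<and> n mod m \<in> R}"

lemma zero_notin_residue_set [simp]: "0 \<notin> residue_set m R"
  by (simp add: residue_set_def)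

lemma eq_upto_residue_set:
  assumes "0 < a" "a < m" "K < n"
  shows "eq_upto K (set_prod c (residue_set m {a})) (\<Prod>k<n. 1 + fps_const c * fps_X ^ (a + m * k))"
proof -
  let ?A = "(\<lambda>k. a + m * k) ` {..<n}"
  have "eq_upto K (set_prod c (residue_set m {a})) (\<Prod>s\<in>?A. 1 + fps_const c * fps_X ^ s)"
  proof (rule eq_upto_set_prod)
    show "residue_set m {a} \<inter> {..K} \<subseteq> ?A"
    proof
      fix s assume s: "s \<in> residue_set m {a} \<inter> {..K}"
      then have "s = a + m * (s div m)"
        by (auto simp: residue_set_def)
      moreover have "s div m < n"
        using s assms div_le_dividend[of s m] by (auto simp del: div_le_dividend)
      ultimately show "s \<in> ?A" by blast
    qed
  qed (use assms in \<open>auto simp: residue_set_def\<close>)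
  also have "(\<Prod>s\<in>?A. 1 + fps_const c * fps_X ^ s) = (\<Prod>k<n. 1 + fps_const c * fps_X ^ (a + m * k))"
    using assms by (subst prod.reindex) (auto simp: inj_on_def)
  finally show ?thesis .
qed

lemma eq_upto_qpoch:
  assumes "0 < m" "K \<le> n"
  shows "eq_upto K (set_prod (-1) (residue_set m {0})) (qpoch m n)"
proof -
  let ?A = "(\<lambda>k. m * Suc k) ` {..<n}"
  have "eq_upto K (set_prod (-1) (residue_set m {0})) (\<Prod>s\<in>?A. 1 + fps_const (-1) * fps_X ^ s)"
  proof (rule eq_upto_set_prod)
    show "residue_set m {0} \<inter> {..K} \<subseteq> ?A"
    proof
      fix s assume s: "s \<in> residue_set m {0} \<inter> {..K}"
      then obtain l where l: "s = m * l" "l > 0"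
        by (auto simp: residue_set_def)
      have "l \<le> s" using l assms by simp
      then have "l - 1 < n" using s l(2) assms(2) by (simp, linarith)
      moreover have "s = m * Suc (l - 1)" using l by simp
      ultimately show "s \<in> ?A" by blast
    qed
  qed (use assms in \<open>auto simp: residue_set_def\<close>)
  also have "(\<Prod>s\<in>?A. 1 + fps_const (-1) * fps_X ^ s) = qpoch m n"
    unfolding qpoch_def using assms
    by (subst prod.reindex) (auto simp: inj_on_def fps_const_minus_one)
  finally show ?thesis .
qed

lemma eq_upto_theta:
  assumes "0 < a" "0 < b" "K \<le> n"
  shows "eq_upto K (theta c a b) (\<Sum>k\<le>n + n. theta_term c a b (int k - int n))"
  unfolding eq_upto_def
proof (intro allI impI)
  fix i assume "i \<le> K"
  have sub: "{j. theta_weight a b j = i} \<subseteq> {- int n..int n}"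
  proof
    fix j assume "j \<in> {j. theta_weight a b j = i}"
    then show "j \<in> {- int n..int n}"
      using abs_le_theta_weight[OF assms(1,2), of j] \<open>i \<le> K\<close> assms(3) by auto
  qed
  have "theta c a b $ i = (\<Sum>j\<in>{j. theta_weight a b j = i}. theta_term c a b j $ i)"
    by (auto simp: theta_def weight_gf_def theta_term_def intro!: sum.cong)
  also have "\<dots> = (\<Sum>j\<in>{- int n..int n}. theta_term c a b j $ i)"
    using sub by (intro sum.mono_neutral_left) (auto simp: theta_term_def)
  also have "\<dots> = (\<Sum>k\<le>n + n. theta_term c a b (int k - int n) $ i)"
    by (rule sum.reindex_bij_witness[of _ "\<lambda>k. int k - int n" "\<lambda>j. nat (j + int n)"]) auto
  finally show "theta c a b $ i = (\<Sum>k\<le>n + n. theta_term c a b (int k - int n)) $ i"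
    by (simp add: fps_sum_nth)
qed

text \<open>In the finite form with equally many factors on both sides, each summand times
  \<open>?E\<close> agrees with the theta term up to order \<open>K\<close>: near the middle the
  binomial is close to the inverse of \<open>?E\<close>, and far from it the term has weight above
  \<open>K\<close>.\<close>

theorem jacobi_triple_product:
  assumes "0 < a" "0 < b" "c * c = 1"
  shows "theta c a b = set_prod c (residue_set (a + b) {a}) * set_prod c (residue_set (a + b) {b})
    * set_prod (-1) (residue_set (a + b) {0})"
proof (rule eq_upto_all_imp_eq)
  fix K
  \<comment> \<open>With \<open>2 * K + 1\<close> factors on each side, an index \<open>k\<close>
    within \<open>K\<close> of the middle leaves both \<open>k\<close> and
    \<open>?n + ?n - k\<close> at least \<open>K\<close>, as the comparison with
    \<open>qpoch\<close> demands.\<close>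
  let ?m = "a + b" and ?E = "set_prod (-1) (residue_set (a + b) {0})" and ?n = "Suc (2 * K)"
  let ?T = "\<lambda>k. theta_term c a b (int k - int ?n)"
  have m: "?m > 0" using assms by simp
  have summand: "eq_upto K (?T k) (qbinom ?m (?n + ?n) k * ?T k * ?E)" if k: "k \<le> ?n + ?n" for k
  proof (cases "\<bar>int k - int ?n\<bar> \<le> int K")
    case True
    then have le: "K \<le> k" "K \<le> ?n + ?n - k" "K \<le> ?n + ?n" by auto
    let ?p = "qpoch ?m k" and ?r = "qpoch ?m (?n + ?n - k)"
    \<comment> \<open>A trivial factor is inserted: its \<open>?r\<close> is then replaced by
      \<open>qpoch ?m (?n + ?n)\<close> and its \<open>?p\<close> by \<open>?E\<close>, both equal
      to it up to order \<open>K\<close>, which produces the binomial.\<close>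
    have "?T k = ?r * inverse ?p * inverse ?r * ?T k * ?p"
    proof -
      have "?r * inverse ?p * inverse ?r * ?T k * ?p = (inverse ?r * ?r) * (inverse ?p * ?p) * ?T k"
        by (simp only: mult_ac)
      then show ?thesis using m by (simp only: inverse_qpoch_mult mult_1)
    qed
    also have "eq_upto K (?r * inverse ?p * inverse ?r * ?T k * ?p)
        (qpoch ?m (?n + ?n) * inverse ?p * inverse ?r * ?T k * ?E)"
    proof (intro eq_upto_mult eq_upto_refl)
      show "eq_upto K ?r (qpoch ?m (?n + ?n))"
        by (rule eq_upto_trans[OF eq_upto_sym[OF eq_upto_qpoch[OF m le(2)]] eq_upto_qpoch[OF m le(3)]])
      show "eq_upto K ?p ?E"
        by (rule eq_upto_sym[OF eq_upto_qpoch[OF m le(1)]])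
    qed
    also have "\<dots> = qbinom ?m (?n + ?n) k * ?T k * ?E"
      using k by (simp add: qbinom_def)
    finally show ?thesis .
  next
    case False
    then have w: "K < theta_weight a b (int k - int ?n)"
      using abs_le_theta_weight[OF assms(1,2), of "int k - int ?n"] by linarith
    have X: "eq_upto K (fps_X ^ theta_weight a b (int k - int ?n) * f) 0" for f
      by (rule eq_upto_X_power_mult[OF w])
    have "?T k = fps_X ^ theta_weight a b (int k - int ?n) * fps_const (theta_sign c (int k - int ?n))"
      by (simp only: theta_term_def mult.commute)
    then have 1: "eq_upto K (?T k) 0"
      by (simp only: X)
    have "qbinom ?m (?n + ?n) k * ?T k * ?E = fps_X ^ theta_weight a b (int k - int ?n)
        * (fps_const (theta_sign c (int k - int ?n)) * qbinom ?m (?n + ?n) k * ?E)"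
      unfolding theta_term_def by (simp only: mult_ac)
    then have 2: "eq_upto K (qbinom ?m (?n + ?n) k * ?T k * ?E) 0"
      by (simp only: X)
    from 1 eq_upto_sym[OF 2] show ?thesis by (rule eq_upto_trans)
  qed
  have "eq_upto K (theta c a b) (\<Sum>k\<le>?n + ?n. ?T k)"
    using assms by (intro eq_upto_theta) auto
  also have "eq_upto K \<dots> (\<Sum>k\<le>?n + ?n. qbinom ?m (?n + ?n) k * ?T k * ?E)"
    by (intro eq_upto_sum summand) simp
  also have "\<dots> = (\<Prod>k<?n. 1 + fps_const c * fps_X ^ (a + ?m * k))
      * (\<Prod>k<?n. 1 + fps_const c * fps_X ^ (b + ?m * k)) * ?E"
    unfolding finite_triple_product[OF m assms(3)] sum_distrib_right ..
  also have "eq_upto K \<dots>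
      (set_prod c (residue_set ?m {a}) * set_prod c (residue_set ?m {b}) * ?E)"
    using assms by (intro eq_upto_mult eq_upto_sym[OF eq_upto_residue_set]) auto
  finally show "eq_upto K (theta c a b)
      (set_prod c (residue_set ?m {a}) * set_prod c (residue_set ?m {b}) * ?E)" .
qed

section \<open>Products over residue classes\<close>

definition res_prod :: "real \<Rightarrow> nat \<Rightarrow> nat set \<Rightarrow> real fps" where
  "res_prod c m R = set_prod c (residue_set m R)"

lemma res_prod_nonzero: "res_prod c m R \<noteq> 0"
  by (simp add: res_prod_def set_prod_nonzero)

lemma res_prod_Un: "A \<inter> B = {} \<Longrightarrow> res_prod c m (A \<union> B) = res_prod c m A * res_prod c m B"
  unfolding res_prod_def
  by (subst set_prod_Un[symmetric]) (auto simp: residue_set_def intro!: arg_cong[of _ _ "set_prod c"])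

text \<open>Doubling the members of the classes \<open>R\<close> modulo \<open>m\<close> gives
  exactly the classes \<open>2 * R\<close> modulo \<open>2 * m\<close>, since a number with an even
  remainder modulo \<open>2 * m\<close> is even.\<close>

lemma res_prod_plus_minus: "res_prod 1 m R * res_prod (-1) m R = res_prod (-1) (2 * m) ((*) 2 ` R)"
proof -
  have "(*) 2 ` residue_set m R = residue_set (2 * m) ((*) 2 ` R)"
  proof (intro equalityI subsetI)
    fix n assume n: "n \<in> residue_set (2 * m) ((*) 2 ` R)"
    then have "2 * (m * (n div (2 * m))) + n mod (2 * m) = n" "even (n mod (2 * m))"
      using mult_div_mod_eq[of "2 * m" n] by (auto simp: residue_set_def mult.assoc)
    then have "even n" by (metis dvd_add_right_iff dvd_triv_left even_add)
    then obtain l where "n = 2 * l" by (elim evenE)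
    with n show "n \<in> (*) 2 ` residue_set m R"
      by (auto simp: residue_set_def mult_mod_right[symmetric])
  qed (auto simp: residue_set_def mult_mod_right[symmetric])
  then show ?thesis by (simp add: res_prod_def set_prod_plus_minus)
qed

text \<open>Each class \<open>r\<close> modulo \<open>m\<close> is the union of the classes
  \<open>r\<close> and \<open>m + r\<close> modulo \<open>2 * m\<close>. The separate variables
  \<open>R'\<close> and \<open>M\<close> allow matching against explicit numerals.\<close>

lemma res_prod_double:
  assumes "R \<subseteq> {..<m}" "R' = R \<union> (+) m ` R" "M = 2 * m"
  shows "res_prod c M R' = res_prod c m R"
proof -
  have "n mod m \<in> R \<longleftrightarrow> n mod (2 * m) \<in> R \<union> (+) m ` R" for n
  proof -
    define r where "r = n mod (2 * m)"
    have r: "n mod m = r mod m" unfolding r_def by (simp add: mod_mod_cancel)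
    show ?thesis
    proof (cases "m = 0")
      case False
      then have "r < 2 * m" by (simp add: r_def)
      then have "r mod m = (if r < m then r else r - m)"
        by (simp add: mod_if)
      then show ?thesis using assms(1) \<open>r < 2 * m\<close> unfolding r r_def[symmetric] by force
    qed (use assms(1) in auto)
  qed
  then show ?thesis using assms(2,3) by (simp add: res_prod_def residue_set_def)
qed

lemma theta_eq_res_prod:
  assumes "0 < a" "a < b" "c * c = 1"
  shows "theta c a b = res_prod c (a + b) {a, b} * res_prod (-1) (a + b) {0}"
  using assms jacobi_triple_product[of a b c] res_prod_Un[of "{a}" "{b}" c "a + b"]
  by (simp add: res_prod_def insert_commute)

text \<open>For \<open>0 < r < M\<close> the remainder of \<open>- r\<close> modulo \<open>M\<close>
  is \<open>M - r\<close>.\<close>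

lemma pm_residues_eq:
  assumes "R \<subseteq> {0<..<int M}"
  shows "pm_residues R (int M) = residue_set M (nat ` R \<union> (\<lambda>r. M - nat r) ` R)"
proof -
  have "[int n = r] (mod int M) \<longleftrightarrow> n mod M = nat r"
    "[int n = - r] (mod int M) \<longleftrightarrow> n mod M = M - nat r" if "r \<in> R" for n r
  proof -
    have r: "0 < r" "r < int M" using that assms by auto
    have "- r mod int M = int M - r"
      using r by (simp add: zmod_zminus1_eq_if)
    then show "[int n = r] (mod int M) \<longleftrightarrow> n mod M = nat r"
      "[int n = - r] (mod int M) \<longleftrightarrow> n mod M = M - nat r"
      using r by (auto simp: cong_def simp flip: of_nat_mod)
  qed
  then show ?thesis
    by (auto simp: pm_residues_def residue_set_def)
qed

section \<open>Products for the four sets modulo 80\<close>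

lemma pm_residues_eqI:
  assumes "R \<subseteq> {0<..<80}" "R' = nat ` R \<union> (\<lambda>r. 80 - nat r) ` R"
  shows "pm_residues R 80 = residue_set 80 R'"
  using pm_residues_eq[of R 80] assms by simp

lemma res_prod_quadruple:
  assumes "R \<subseteq> {..<m}" "R' = R \<union> (+) m ` R \<union> (+) (2 * m) ` (R \<union> (+) m ` R)" "M = 4 * m"
  shows "res_prod c M R' = res_prod c m R"
proof -
  have "res_prod c M R' = res_prod c (2 * m) (R \<union> (+) m ` R)"
    using assms by (intro res_prod_double) auto
  also have "\<dots> = res_prod c m R"
    using assms by (intro res_prod_double) auto
  finally show ?thesis .
qed

lemma res_prod_split:
  assumes "R = A \<union> B \<union> (C \<union> D)" "A \<inter> B = {}" "C \<inter> D = {}" "(A \<union> B) \<inter> (C \<union> D) = {}"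
  shows "res_prod c m R = res_prod c m A * res_prod c m B * (res_prod c m C * res_prod c m D)"
  unfolding assms(1) by (simp only: res_prod_Un assms(2-4))

text \<open>Two doublings follow each other. The factors \<open>1 + q^s\<close> over
  \<open>C\<close> turn \<open>C\<close> modulo 40 into \<open>2 * C\<close> modulo 80; together
  with \<open>B\<close> this fills the classes \<open>G\<close> modulo 20, and the factors over
  \<open>G\<close> turn these into \<open>2 * G\<close> modulo 40.\<close>

lemma pm_residues_prod:
  assumes S: "set_prod (-1) S = res_prod (-1) 20 {5, 15} * res_prod (-1) 40 A
      * (res_prod (-1) 80 B * res_prod (-1) 40 C)"
    and G: "res_prod (-1) 20 G = res_prod (-1) 80 B * res_prod (-1) 80 ((*) 2 ` C)"
  shows "set_prod (-1) S * (res_prod 1 40 C * res_prod 1 20 G)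
    = res_prod (-1) 20 {5, 15} * res_prod (-1) 40 A * res_prod (-1) 40 ((*) 2 ` G)"
proof -
  have C: "res_prod 1 40 C * res_prod (-1) 40 C = res_prod (-1) 80 ((*) 2 ` C)"
    using res_prod_plus_minus[of 40 C] by simp
  have "set_prod (-1) S * (res_prod 1 40 C * res_prod 1 20 G)
      = res_prod (-1) 20 {5, 15} * res_prod (-1) 40 A
        * (res_prod 1 20 G * (res_prod (-1) 80 B * (res_prod 1 40 C * res_prod (-1) 40 C)))"
    unfolding S by (simp only: mult_ac)
  also have "\<dots> = res_prod (-1) 20 {5, 15} * res_prod (-1) 40 A
        * (res_prod 1 20 G * res_prod (-1) 20 G)"
    by (simp only: G C)
  finally show ?thesis using res_prod_plus_minus[of 20 G] by simp
qed

text \<open>Doubling \<open>7, 33, 17, 23\<close> gives \<open>14, 66, 34, 46\<close>, which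
  together with \<open>6, 26, 54, 74\<close> are all classes modulo 80 lying over
  \<open>6, 14\<close> modulo 20.\<close>

lemma set_prod_pm_residues_S1:
  "set_prod (-1) (pm_residues {4, 5, 6, 7, 15, 17, 23, 25, 26, 33, 35, 36} 80)
    * (res_prod 1 40 {7, 33, 17, 23} * res_prod 1 20 {6, 14})
    = res_prod (-1) 20 {5, 15} * res_prod (-1) 40 {4, 36} * res_prod (-1) 40 {12, 28}"
proof -
  have "pm_residues {4, 5, 6, 7, 15, 17, 23, 25, 26, 33, 35, 36} 80
      = residue_set 80 {4, 5, 6, 7, 15, 17, 23, 25, 26, 33, 35, 36, 44, 45, 47, 54, 55, 57, 63, 65, 73, 74, 75, 76}"
    by (rule pm_residues_eqI) auto
  then have "set_prod (-1) (pm_residues {4, 5, 6, 7, 15, 17, 23, 25, 26, 33, 35, 36} 80)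
      = res_prod (-1) 80 {4, 5, 6, 7, 15, 17, 23, 25, 26, 33, 35, 36, 44, 45, 47, 54, 55, 57, 63, 65, 73, 74, 75, 76}"
    by (simp only: res_prod_def)
  also have "\<dots> = res_prod (-1) 80 {5, 15, 25, 35, 45, 55, 65, 75} * res_prod (-1) 80 {4, 36, 44, 76}
      * (res_prod (-1) 80 {6, 26, 54, 74} * res_prod (-1) 80 {7, 17, 23, 33, 47, 57, 63, 73})"
    by (rule res_prod_split) auto
  also have "res_prod (-1) 80 {5, 15, 25, 35, 45, 55, 65, 75} = res_prod (-1) 20 {5, 15}"
    by (rule res_prod_quadruple) auto
  also have "res_prod (-1) 80 {4, 36, 44, 76} = res_prod (-1) 40 {4, 36}"
    by (rule res_prod_double) auto
  also have "res_prod (-1) 80 {7, 17, 23, 33, 47, 57, 63, 73} = res_prod (-1) 40 {7, 33, 17, 23}"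
    by (rule res_prod_double) auto
  finally have S: "set_prod (-1) (pm_residues {4, 5, 6, 7, 15, 17, 23, 25, 26, 33, 35, 36} 80)
      = res_prod (-1) 20 {5, 15} * res_prod (-1) 40 {4, 36}
      * (res_prod (-1) 80 {6, 26, 54, 74} * res_prod (-1) 40 {7, 33, 17, 23})" .
  have "res_prod (-1) 20 {6, 14} = res_prod (-1) 80 {6, 14, 26, 34, 46, 54, 66, 74}"
    by (rule res_prod_quadruple[symmetric]) auto
  also have "\<dots> = res_prod (-1) 80 ({6, 26, 54, 74} \<union> (*) 2 ` {7, 33, 17, 23})"
    by (rule arg_cong[of _ _ "res_prod (-1) 80"]) auto
  also have "\<dots> = res_prod (-1) 80 {6, 26, 54, 74} * res_prod (-1) 80 ((*) 2 ` {7, 33, 17, 23})"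
    by (rule res_prod_Un) auto
  finally show ?thesis
    using pm_residues_prod[OF S] by simp
qed

text \<open>Here the doubled classes complete \<open>2, 18\<close> modulo 20. The roles of
  \<open>{4, 36}\<close> and \<open>{12, 28}\<close> are exchanged: one comes from the set itself
  and the other from doubling, so the right-hand side is the same product.\<close>

lemma set_prod_pm_residues_T1:
  "set_prod (-1) (pm_residues {2, 5, 11, 12, 15, 18, 19, 21, 25, 28, 29, 35} 80)
    * (res_prod 1 40 {11, 29, 19, 21} * res_prod 1 20 {2, 18})
    = res_prod (-1) 20 {5, 15} * res_prod (-1) 40 {12, 28} * res_prod (-1) 40 {4, 36}"
proof -
  have "pm_residues {2, 5, 11, 12, 15, 18, 19, 21, 25, 28, 29, 35} 80
      = residue_set 80 {2, 5, 11, 12, 15, 18, 19, 21, 25, 28, 29, 35, 45, 51, 52, 55, 59, 61, 62, 65, 68, 69, 75, 78}"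
    by (rule pm_residues_eqI) auto
  then have "set_prod (-1) (pm_residues {2, 5, 11, 12, 15, 18, 19, 21, 25, 28, 29, 35} 80)
      = res_prod (-1) 80 {2, 5, 11, 12, 15, 18, 19, 21, 25, 28, 29, 35, 45, 51, 52, 55, 59, 61, 62, 65, 68, 69, 75, 78}"
    by (simp only: res_prod_def)
  also have "\<dots> = res_prod (-1) 80 {5, 15, 25, 35, 45, 55, 65, 75} * res_prod (-1) 80 {12, 28, 52, 68}
      * (res_prod (-1) 80 {2, 18, 62, 78} * res_prod (-1) 80 {11, 19, 21, 29, 51, 59, 61, 69})"
    by (rule res_prod_split) auto
  also have "res_prod (-1) 80 {5, 15, 25, 35, 45, 55, 65, 75} = res_prod (-1) 20 {5, 15}"
    by (rule res_prod_quadruple) auto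
  also have "res_prod (-1) 80 {12, 28, 52, 68} = res_prod (-1) 40 {12, 28}"
    by (rule res_prod_double) auto
  also have "res_prod (-1) 80 {11, 19, 21, 29, 51, 59, 61, 69} = res_prod (-1) 40 {11, 29, 19, 21}"
    by (rule res_prod_double) auto
  finally have S: "set_prod (-1) (pm_residues {2, 5, 11, 12, 15, 18, 19, 21, 25, 28, 29, 35} 80)
      = res_prod (-1) 20 {5, 15} * res_prod (-1) 40 {12, 28}
      * (res_prod (-1) 80 {2, 18, 62, 78} * res_prod (-1) 40 {11, 29, 19, 21})" .
  have "res_prod (-1) 20 {2, 18} = res_prod (-1) 80 {2, 18, 22, 38, 42, 58, 62, 78}"
    by (rule res_prod_quadruple[symmetric]) auto
  also have "\<dots> = res_prod (-1) 80 ({2, 18, 62, 78} \<union> (*) 2 ` {11, 29, 19, 21})"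
    by (rule arg_cong[of _ _ "res_prod (-1) 80"]) auto
  also have "\<dots> = res_prod (-1) 80 {2, 18, 62, 78} * res_prod (-1) 80 ((*) 2 ` {11, 29, 19, 21})"
    by (rule res_prod_Un) auto
  finally show ?thesis
    using pm_residues_prod[OF S] by simp
qed

text \<open>The classes over \<open>6, 14\<close> modulo 20 are again completed, with the halves
  exchanged: now \<open>6, 26, 54, 74\<close> come from doubling and \<open>14, 34, 46, 66\<close>
  from the set.\<close>

lemma set_prod_pm_residues_S2:
  "set_prod (-1) (pm_residues {3, 4, 5, 13, 14, 15, 25, 27, 34, 35, 36, 37} 80)
    * (res_prod 1 40 {3, 37, 13, 27} * res_prod 1 20 {6, 14})
    = res_prod (-1) 20 {5, 15} * res_prod (-1) 40 {4, 36} * res_prod (-1) 40 {12, 28}"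
proof -
  have "pm_residues {3, 4, 5, 13, 14, 15, 25, 27, 34, 35, 36, 37} 80
      = residue_set 80 {3, 4, 5, 13, 14, 15, 25, 27, 34, 35, 36, 37, 43, 44, 45, 46, 53, 55, 65, 66, 67, 75, 76, 77}"
    by (rule pm_residues_eqI) auto
  then have "set_prod (-1) (pm_residues {3, 4, 5, 13, 14, 15, 25, 27, 34, 35, 36, 37} 80)
      = res_prod (-1) 80 {3, 4, 5, 13, 14, 15, 25, 27, 34, 35, 36, 37, 43, 44, 45, 46, 53, 55, 65, 66, 67, 75, 76, 77}"
    by (simp only: res_prod_def)
  also have "\<dots> = res_prod (-1) 80 {5, 15, 25, 35, 45, 55, 65, 75} * res_prod (-1) 80 {4, 36, 44, 76}
      * (res_prod (-1) 80 {14, 34, 46, 66} * res_prod (-1) 80 {3, 13, 27, 37, 43, 53, 67, 77})"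
    by (rule res_prod_split) auto
  also have "res_prod (-1) 80 {5, 15, 25, 35, 45, 55, 65, 75} = res_prod (-1) 20 {5, 15}"
    by (rule res_prod_quadruple) auto
  also have "res_prod (-1) 80 {4, 36, 44, 76} = res_prod (-1) 40 {4, 36}"
    by (rule res_prod_double) auto
  also have "res_prod (-1) 80 {3, 13, 27, 37, 43, 53, 67, 77} = res_prod (-1) 40 {3, 37, 13, 27}"
    by (rule res_prod_double) auto
  finally have S: "set_prod (-1) (pm_residues {3, 4, 5, 13, 14, 15, 25, 27, 34, 35, 36, 37} 80)
      = res_prod (-1) 20 {5, 15} * res_prod (-1) 40 {4, 36}
      * (res_prod (-1) 80 {14, 34, 46, 66} * res_prod (-1) 40 {3, 37, 13, 27})" .
  have "res_prod (-1) 20 {6, 14} = res_prod (-1) 80 {6, 14, 26, 34, 46, 54, 66, 74}"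
    by (rule res_prod_quadruple[symmetric]) auto
  also have "\<dots> = res_prod (-1) 80 ({14, 34, 46, 66} \<union> (*) 2 ` {3, 37, 13, 27})"
    by (rule arg_cong[of _ _ "res_prod (-1) 80"]) auto
  also have "\<dots> = res_prod (-1) 80 {14, 34, 46, 66} * res_prod (-1) 80 ((*) 2 ` {3, 37, 13, 27})"
    by (rule res_prod_Un) auto
  finally show ?thesis
    using pm_residues_prod[OF S] by simp
qed

text \<open>The classes over \<open>2, 18\<close> modulo 20 are completed with
  \<open>2, 18, 62, 78\<close> coming from doubling.\<close>

lemma set_prod_pm_residues_T2:
  "set_prod (-1) (pm_residues {1, 5, 9, 12, 15, 22, 25, 28, 31, 35, 38, 39} 80)
    * (res_prod 1 40 {1, 39, 9, 31} * res_prod 1 20 {2, 18})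
    = res_prod (-1) 20 {5, 15} * res_prod (-1) 40 {12, 28} * res_prod (-1) 40 {4, 36}"
proof -
  have "pm_residues {1, 5, 9, 12, 15, 22, 25, 28, 31, 35, 38, 39} 80
      = residue_set 80 {1, 5, 9, 12, 15, 22, 25, 28, 31, 35, 38, 39, 41, 42, 45, 49, 52, 55, 58, 65, 68, 71, 75, 79}"
    by (rule pm_residues_eqI) auto
  then have "set_prod (-1) (pm_residues {1, 5, 9, 12, 15, 22, 25, 28, 31, 35, 38, 39} 80)
      = res_prod (-1) 80 {1, 5, 9, 12, 15, 22, 25, 28, 31, 35, 38, 39, 41, 42, 45, 49, 52, 55, 58, 65, 68, 71, 75, 79}"
    by (simp only: res_prod_def)
  also have "\<dots> = res_prod (-1) 80 {5, 15, 25, 35, 45, 55, 65, 75} * res_prod (-1) 80 {12, 28, 52, 68}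
      * (res_prod (-1) 80 {22, 38, 42, 58} * res_prod (-1) 80 {1, 9, 31, 39, 41, 49, 71, 79})"
    by (rule res_prod_split) auto
  also have "res_prod (-1) 80 {5, 15, 25, 35, 45, 55, 65, 75} = res_prod (-1) 20 {5, 15}"
    by (rule res_prod_quadruple) auto
  also have "res_prod (-1) 80 {12, 28, 52, 68} = res_prod (-1) 40 {12, 28}"
    by (rule res_prod_double) auto
  also have "res_prod (-1) 80 {1, 9, 31, 39, 41, 49, 71, 79} = res_prod (-1) 40 {1, 39, 9, 31}"
    by (rule res_prod_double) auto
  finally have S: "set_prod (-1) (pm_residues {1, 5, 9, 12, 15, 22, 25, 28, 31, 35, 38, 39} 80)
      = res_prod (-1) 20 {5, 15} * res_prod (-1) 40 {12, 28}
      * (res_prod (-1) 80 {22, 38, 42, 58} * res_prod (-1) 40 {1, 39, 9, 31})" .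
  have "res_prod (-1) 20 {2, 18} = res_prod (-1) 80 {2, 18, 22, 38, 42, 58, 62, 78}"
    by (rule res_prod_quadruple[symmetric]) auto
  also have "\<dots> = res_prod (-1) 80 ({22, 38, 42, 58} \<union> (*) 2 ` {1, 39, 9, 31})"
    by (rule arg_cong[of _ _ "res_prod (-1) 80"]) auto
  also have "\<dots> = res_prod (-1) 80 {22, 38, 42, 58} * res_prod (-1) 80 ((*) 2 ` {1, 39, 9, 31})"
    by (rule res_prod_Un) auto
  finally show ?thesis
    using pm_residues_prod[OF S] by simp
qed

section \<open>The two identities\<close>

abbreviation "euler20 \<equiv> res_prod (-1) 20 {0}"

abbreviation "euler40 \<equiv> res_prod (-1) 40 {0}"

text \<open>The Euler product turns the pair into a theta series, which is then dissected. The new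
  arguments add up to \<open>4 * m\<close>, which is 80 for \<open>m = 20\<close>.\<close>

lemma res_prod_pair_eq_theta:
  assumes "a + b = m" "0 < a" "a < b" "e * e = 1"
  shows "res_prod e m {a, b} * res_prod (-1) m {0}
    = theta 1 (3 * a + b) (a + 3 * b) + fps_const e * fps_X ^ a * theta 1 (b - a) (5 * a + 3 * b)"
  using assms theta_eq_res_prod[of a b e] theta_dissect[of a b e] by simp

text \<open>Two theta series are multiplied, which costs two Euler products. The new arguments add
  up to \<open>2 * m\<close>; for \<open>m = 40\<close> this is 80, the same total as for a
  dissected pair modulo 20.\<close>

lemma res_prod_quad_eq_theta:
  assumes "a + b = m" "c + d = m" "0 < a" "a < c" "c < d" "e * e = 1"
  shows "res_prod e m {a, b, c, d} * res_prod (-1) m {0} ^ 2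
    = theta 1 (a + c) (b + d) * theta 1 (a + d) (b + c)
    + fps_const e * fps_X ^ a * (theta 1 (b - c) (a + 2 * c + d) * theta 1 (b - d) (a + c + 2 * d))"
proof -
  have "{a, b, c, d} = {a, b} \<union> {c, d}" "{a, b} \<inter> {c, d} = {}"
    using assms by auto
  then have "res_prod e m {a, b, c, d} * res_prod (-1) m {0} ^ 2
      = (res_prod e m {a, b} * res_prod (-1) m {0}) * (res_prod e m {c, d} * res_prod (-1) m {0})"
    by (simp only: res_prod_Un power2_eq_square mult_ac)
  also have "\<dots> = theta e a b * theta e c d"
    using assms theta_eq_res_prod[of a b e] theta_eq_res_prod[of c d e] by simp
  finally show ?thesis
    using assms theta_mult[of a b c d e] by simp
qed

lemma partition_gf_eq_of_prod:
  assumes "set_prod (-1) S * u = k" "0 \<notin> S"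
  shows "k * partition_gf S = u"
proof -
  have "k * partition_gf S = (set_prod (-1) S * partition_gf S) * u"
    unfolding assms(1)[symmetric] by (simp only: mult_ac)
  then show ?thesis using set_prod_partition_gf[OF assms(2)] by simp
qed

theorem theorem19p1:
  shows "(let S = pm_residues {4, 5, 6, 7, 15, 17, 23, 25, 26, 33, 35, 36} 80;
              T = pm_residues {2, 5, 11, 12, 15, 18, 19, 21, 25, 28, 29, 35} 80
          in \<forall>n::nat. n \<noteq> 2 \<longrightarrow> num_partitions S n = num_partitions T n)
       \<and> (let S = pm_residues {3, 4, 5, 13, 14, 15, 25, 27, 34, 35, 36, 37} 80;
              T = pm_residues {1, 5, 9, 12, 15, 22, 25, 28, 31, 35, 38, 39} 80
          in \<forall>n::nat. n \<ge> 3 \<longrightarrow> num_partitions S n = num_partitions T (n - 3))"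
proof -
  let ?S1 = "pm_residues {4, 5, 6, 7, 15, 17, 23, 25, 26, 33, 35, 36} 80"
  let ?T1 = "pm_residues {2, 5, 11, 12, 15, 18, 19, 21, 25, 28, 29, 35} 80"
  let ?S2 = "pm_residues {3, 4, 5, 13, 14, 15, 25, 27, 34, 35, 36, 37} 80"
  let ?T2 = "pm_residues {1, 5, 9, 12, 15, 22, 25, 28, 31, 35, 38, 39} 80"
  define X :: "real fps" where "X = fps_X"
  define t1 t2 where "t1 = theta 1 30 50" and "t2 = theta 1 10 70"
  define g1 g2 g3 g4 where "g1 = theta 1 8 72" and "g2 = theta 1 16 64"
    and "g3 = theta 1 24 56" and "g4 = theta 1 32 48"
  note defs = X_def t1_def t2_def g1_def g2_def g3_def g4_def
  define K where "K = res_prod (-1) 20 {5, 15} * res_prod (-1) 40 {4, 36} * res_prod (-1) 40 {12, 28}"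
  \<comment> \<open>These are exactly the Euler products that convert one quadruple modulo 40 and
    one pair modulo 20 into theta series; \<open>K\<close> and all four numerators need the same
    ones.\<close>
  define E where "E = euler40 ^ 2 * euler20"
  define a1 b1 a2 b2 where "a1 = res_prod 1 40 {7, 33, 17, 23}"
    and "b1 = res_prod 1 40 {11, 29, 19, 21}"
    and "a2 = res_prod 1 40 {3, 37, 13, 27}"
    and "b2 = res_prod 1 40 {1, 39, 9, 31}"
  define d2 d6 where "d2 = res_prod 1 20 {2, 18}" and "d6 = res_prod 1 20 {6, 14}"

  have a1: "a1 * euler40 ^ 2 = g3 * t1 + X ^ 7 * (g2 * t2)"
    using res_prod_quad_eq_theta[of 7 33 40 17 23 1] by (simp add: defs a1_def)
  have b1: "b1 * euler40 ^ 2 = t1 * g4 + X ^ 11 * (t2 * g1)"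
    using res_prod_quad_eq_theta[of 11 29 40 19 21 1] by (simp add: defs b1_def)
  have a2: "a2 * euler40 ^ 2 = g2 * t1 + X ^ 3 * (g3 * t2)"
    using res_prod_quad_eq_theta[of 3 37 40 13 27 1] by (simp add: defs a2_def)
  have b2: "b2 * euler40 ^ 2 = t2 * g4 + X * (t1 * g1)"
    using res_prod_quad_eq_theta[of 1 39 40 9 31 1] by (simp add: defs b2_def)
  have d2: "d2 * euler20 = g3 + X ^ 2 * g2"
    using res_prod_pair_eq_theta[of 2 18 20 1] by (simp add: defs d2_def)
  have d6: "d6 * euler20 = g4 + X ^ 6 * g1"
    using res_prod_pair_eq_theta[of 6 14 20 1] by (simp add: defs d6_def)
  have K: "K * E = (t1 - X ^ 5 * t2) * (g2 * g4 - X ^ 4 * (g3 * g1))"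
  proof -
    have "res_prod (-1) 20 {5, 15} * euler20 = t1 - X ^ 5 * t2"
      using res_prod_pair_eq_theta[of 5 15 20 "-1"] by (simp add: defs fps_const_minus_one)
    moreover have "res_prod (-1) 40 {4, 36, 12, 28} * euler40 ^ 2 = g2 * g4 - X ^ 4 * (g3 * g1)"
      using res_prod_quad_eq_theta[of 4 36 40 12 28 "-1"] by (simp add: defs fps_const_minus_one)
    moreover have "res_prod (-1) 40 {4, 36, 12, 28} = res_prod (-1) 40 {4, 36} * res_prod (-1) 40 {12, 28}"
    proof -
      have "{4, 36, 12, 28} = {4, 36} \<union> {12, 28 :: nat}" by auto
      then show ?thesis by (simp only:) (rule res_prod_Un, simp)
    qed
    moreover have "K * E = (res_prod (-1) 20 {5, 15} * euler20)
        * ((res_prod (-1) 40 {4, 36} * res_prod (-1) 40 {12, 28}) * euler40 ^ 2)"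
      unfolding K_def E_def by (simp only: mult_ac)
    ultimately show ?thesis by simp
  qed

  have pos: "0 \<notin> pm_residues R 80" for R
    by (simp add: pm_residues_def)
  have gf: "K * partition_gf ?S1 = a1 * d6" "K * partition_gf ?T1 = b1 * d2"
    "K * partition_gf ?S2 = a2 * d6" "K * partition_gf ?T2 = b2 * d2"
    using set_prod_pm_residues_S1 set_prod_pm_residues_T1 set_prod_pm_residues_S2 set_prod_pm_residues_T2
    unfolding K_def a1_def b1_def a2_def b2_def d2_def d6_def
    by (intro partition_gf_eq_of_prod pos; simp add: mult_ac)+

  have nz: "K * E \<noteq> 0"
    by (simp add: K_def E_def res_prod_nonzero)
  have scaled: "K * E * f = (a * euler40 ^ 2) * (d * euler20)" if "K * f = a * d" for f a d
  proof -
    have "K * E * f = (K * f) * E" by (simp only: mult_ac)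
    then show ?thesis unfolding that E_def by (simp only: mult_ac)
  qed
  \<comment> \<open>In the difference of the two expanded numerators the terms
    \<open>t1 * g3 * g4\<close> and \<open>X ^ 13 * t2 * g1 * g2\<close> cancel; the remaining four
    are \<open>X ^ 2\<close> times the expansion of \<open>K * E\<close>.\<close>
  have "K * E * partition_gf ?T1 = K * E * (partition_gf ?S1 + X ^ 2)"
    unfolding distrib_left scaled[OF gf(1)] scaled[OF gf(2)] unfolding a1 b1 d2 d6 K
    by (simp add: algebra_simps eval_nat_numeral)
  then have one: "partition_gf ?T1 = partition_gf ?S1 + X ^ 2"
    by (rule mult_left_cancel[OF nz, THEN iffD1])
  have swap: "K * E * (X ^ 3 * f + 1) = X ^ 3 * (K * E * f) + K * E" for f
    by (simp add: algebra_simps)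
  \<comment> \<open>Here \<open>X ^ 3 * t2 * g3 * g4\<close> and \<open>X ^ 6 * t1 * g1 * g2\<close>
    cancel, and the rest is the expansion of \<open>K * E\<close> itself.\<close>
  have "K * E * partition_gf ?S2 = K * E * (X ^ 3 * partition_gf ?T2 + 1)"
    unfolding swap scaled[OF gf(3)] scaled[OF gf(4)] unfolding a2 b2 d2 d6 K
    by (simp add: algebra_simps eval_nat_numeral)
  then have two: "partition_gf ?S2 = X ^ 3 * partition_gf ?T2 + 1"
    by (rule mult_left_cancel[OF nz, THEN iffD1])
  \<comment> \<open>The correction \<open>X ^ 2\<close> is the sole source of the exception
    \<open>n = 2\<close>; in the second identity the correction 1 only affects the coefficient at
    0.\<close>
  have "num_partitions ?S1 n = num_partitions ?T1 n" if "n \<noteq> 2" for n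
    using arg_cong[OF one, of "\<lambda>f. f $ n"] that by (simp add: partition_gf_nth X_def)
  moreover have "num_partitions ?S2 n = num_partitions ?T2 (n - 3)" if "n \<ge> 3" for n
    using arg_cong[OF two, of "\<lambda>f. f $ n"] that
    by (simp add: partition_gf_nth X_def fps_X_power_mult_nth)
  ultimately show ?thesis by (simp add: Let_def)
qed

end
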